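(* Let $\mathcal{A},\mathcal{B}\in\mathbb{C}^{\mathbf{N}(n)\times\mathbf{N}(n)}$ be two core tensors with $\mathrm{ind}(\mathcal{A}*_n\mathcal{B})=1$. (a) If $\mathcal{B}$ is unitary and $\mathscr{R}(\mathcal{B}^**_n\mathcal{A}^{\mathrm{core}})\subseteq\mathscr{R}(\mathcal{A}^{\mathrm{core}})$, then $(\mathcal{A}*_n\mathcal{B})^{\mathrm{core}}=\mathcal{B}^**_n\mathcal{A}^{\mathrm{core}}$. (b) If $\mathcal{A}$ is unitary and $\mathscr{R}(\mathcal{A})\subseteq\mathscr{R}(\mathcal{B})$, then $(\mathcal{A}*_n\mathcal{B})^{\mathrm{core}}=\mathcal{B}^{\mathrm{core}}*_n\mathcal{A}^*$.
   Context: Here $\mathbf{N}(n)=N_1\times\cdots\times N_n$ and $\mathbb{C}^{\mathbf{N}(n)\times\mathbf{N}(n)}$ is the set of complex tensors $\mathcal{A}=(a_{i_1\ldots i_n j_1\ldots j_n})$ with $1\le i_k,j_k\le N_k$. The Einstein product is $(\mathcal{A}*_n\mathcal{B})_{i_1\ldots i_n j_1\ldots j_n}=\sum_{k_1,\ldots,k_n}a_{i_1\ldots i_n k_1\ldots k_n}b_{k_1\ldots k_n j_1\ldots j_n}$ (and similarly $\mathcal{A}*_n\mathcal{X}\in\mathbb{C}^{\mathbf{N}(n)}$ for $\mathcal{X}\in\mathbb{C}^{\mathbf{N}(n)}$), powers are taken with respect to $*_n$, and $\mathcal{A}^*$ is the conjugate transpose (swap the first $n$ and last $n$ indices and conjugate).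 $\mathcal{A}$ is unitary if $\mathcal{A}*_n\mathcal{A}^*=\mathcal{A}^**_n\mathcal{A}=\mathcal{I}$, the identity tensor. The range is $\mathscr{R}(\mathcal{A})=\{\mathcal{A}*_n\mathcal{X}:\mathcal{X}\in\mathbb{C}^{\mathbf{N}(n)}\}$. The index $\mathrm{ind}(\mathcal{A})$ is the smallest positive integer $k$ with $\mathscr{R}(\mathcal{A}^k)=\mathscr{R}(\mathcal{A}^{k+1})$; $\mathcal{A}$ is a core tensor if $\mathrm{ind}(\mathcal{A})=1$. The core inverse $\mathcal{A}^{\mathrm{core}}$ is the (unique, existing when $\mathcal{A}$ is a core tensor) tensor $\mathcal{X}$ with $(\mathcal{A}*_n\mathcal{X})^*=\mathcal{A}*_n\mathcal{X}$, $\mathcal{X}*_n\mathcal{A}^2=\mathcal{A}$, $\mathcal{A}*_n\mathcal{X}^2=\mathcal{X}$. *)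

theory Defs
  imports Complex_Main "HOL-Library.FuncSet"
begin

text \<open>
  A size vector \<open>N\<^sub>1 \<times> \<dots> \<times> N\<^sub>n\<close> is given by \<open>n\<close> and a function \<open>N\<close> of which only the values
  at \<open>1, \<dots>, n\<close> matter. Multi-indices are the extensional functions \<open>i\<close> with
  \<open>1 \<le> i k \<le> N k\<close>. Tensors are extensional in each multi-index as well, so that HOL equality
  of elements of the carriers below is equality of tensors, entry by entry.
\<close>

type_synonym mindex = "nat \<Rightarrow> nat"
type_synonym vtensor = "mindex \<Rightarrow> complex"
type_synonym tensor = "mindex \<Rightarrow> mindex \<Rightarrow> complex"

definition mindices :: "nat \<Rightarrow> (nat \<Rightarrow> nat) \<Rightarrow> mindex set" where
  "mindices n N = (\<Pi>\<^sub>E k\<in>{1..n}. {1..N k})"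

definition vtensors :: "nat \<Rightarrow> (nat \<Rightarrow> nat) \<Rightarrow> vtensor set" where
  "vtensors n N = mindices n N \<rightarrow>\<^sub>E UNIV"

definition tensors :: "nat \<Rightarrow> (nat \<Rightarrow> nat) \<Rightarrow> tensor set" where
  "tensors n N = mindices n N \<rightarrow>\<^sub>E (mindices n N \<rightarrow>\<^sub>E UNIV)"

definition einstein :: "nat \<Rightarrow> (nat \<Rightarrow> nat) \<Rightarrow> tensor \<Rightarrow> tensor \<Rightarrow> tensor" where
  "einstein n N A B =
     (\<lambda>i\<in>mindices n N. \<lambda>j\<in>mindices n N. \<Sum>k\<in>mindices n N. A i k * B k j)"

definition einstein_vec :: "nat \<Rightarrow> (nat \<Rightarrow> nat) \<Rightarrow> tensor \<Rightarrow> vtensor \<Rightarrow> vtensor" where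
  "einstein_vec n N A X = (\<lambda>i\<in>mindices n N. \<Sum>k\<in>mindices n N. A i k * X k)"

definition tensor_id :: "nat \<Rightarrow> (nat \<Rightarrow> nat) \<Rightarrow> tensor" where
  "tensor_id n N = (\<lambda>i\<in>mindices n N. \<lambda>j\<in>mindices n N. if i = j then 1 else 0)"

primrec tensor_pow :: "nat \<Rightarrow> (nat \<Rightarrow> nat) \<Rightarrow> tensor \<Rightarrow> nat \<Rightarrow> tensor" where
  "tensor_pow n N A 0 = tensor_id n N"
| "tensor_pow n N A (Suc p) = einstein n N A (tensor_pow n N A p)"

definition tensor_adj :: "nat \<Rightarrow> (nat \<Rightarrow> nat) \<Rightarrow> tensor \<Rightarrow> tensor" where
  "tensor_adj n N A = (\<lambda>i\<in>mindices n N. \<lambda>j\<in>mindices n N. cnj (A j i))"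

definition tensor_unitary :: "nat \<Rightarrow> (nat \<Rightarrow> nat) \<Rightarrow> tensor \<Rightarrow> bool" where
  "tensor_unitary n N A \<longleftrightarrow>
     einstein n N A (tensor_adj n N A) = tensor_id n N \<and>
     einstein n N (tensor_adj n N A) A = tensor_id n N"

definition tensor_range :: "nat \<Rightarrow> (nat \<Rightarrow> nat) \<Rightarrow> tensor \<Rightarrow> vtensor set" where
  "tensor_range n N A = einstein_vec n N A ` vtensors n N"

text \<open>The ranges of the powers decrease in a finite-dimensional space, so the least exponent
  below exists for every tensor.\<close>

definition tensor_ind :: "nat \<Rightarrow> (nat \<Rightarrow> nat) \<Rightarrow> tensor \<Rightarrow> nat" where
  "tensor_ind n N A =
     (LEAST k. 1 \<le> k \<and>
        tensor_range n N (tensor_pow n N A k) = tensor_range n N (tensor_pow n N A (k + 1)))"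

definition core_tensor :: "nat \<Rightarrow> (nat \<Rightarrow> nat) \<Rightarrow> tensor \<Rightarrow> bool" where
  "core_tensor n N A \<longleftrightarrow> A \<in> tensors n N \<and> tensor_ind n N A = 1"

definition is_core_inverse :: "nat \<Rightarrow> (nat \<Rightarrow> nat) \<Rightarrow> tensor \<Rightarrow> tensor \<Rightarrow> bool" where
  "is_core_inverse n N A X \<longleftrightarrow>
     X \<in> tensors n N \<and>
     tensor_adj n N (einstein n N A X) = einstein n N A X \<and>
     einstein n N X (tensor_pow n N A 2) = A \<and>
     einstein n N A (tensor_pow n N X 2) = X"

text \<open>Meaningful for core tensors only: these have exactly one core inverse.\<close>

definition core_inverse :: "nat \<Rightarrow> (nat \<Rightarrow> nat) \<Rightarrow> tensor \<Rightarrow> tensor" where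
  "core_inverse n N A = (THE X. is_core_inverse n N A X)"

end

theory Submission
  imports Defs "HOL-Algebra.Group"
begin

text \<open>
  Under the Einstein product the square tensors form a monoid with involution, and the argument
  uses only two facts about it. The involution is proper: \<open>A\<^sup>* A C = A\<^sup>* A D\<close> implies
  \<open>A C = A D\<close>, because \<open>\<parallel>A x\<parallel>\<^sup>2 = \<langle>x, A\<^sup>* A x\<rangle>\<close>. And every element is strongly \<open>\<pi>\<close>-regular:
  \<open>A\<^sup>m = A\<^sup>m\<^sup>+\<^sup>1 S\<close> for some \<open>m\<close> and some \<open>S\<close> commuting with \<open>A\<close>, because the powers of \<open>A\<close> are
  linearly dependent. The second fact replaces all dimension counting.

  Inclusions of ranges turn into factorisations: \<open>R(A) \<subseteq> R(B)\<close> iff \<open>A = B Y\<close> for some \<open>Y\<close>.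
  By \<open>\<pi>\<close>-regularity the ranges of the powers of \<open>A\<close> stabilise, so index one means \<open>A = A\<^sup>2 Y\<close>,
  and then \<open>A = S A\<^sup>2\<close> with \<open>S\<close> commuting with \<open>A\<close>. Applied to \<open>A\<^sup>* A\<close>, the two facts give
  a self-adjoint \<open>E = A W\<close> with \<open>E A = A\<close>. Then \<open>S E\<close> is a core inverse of \<open>A\<close>
  (\<open>core_inv_exists\<close>); uniqueness is a direct computation (\<open>core_inv_unique\<close>).

  For the first claim let \<open>X\<close> be the core inverse of \<open>A\<close>, so that \<open>P = A X\<close> is the orthogonal
  projection onto \<open>R(A) = R(X)\<close>. The hypothesis says that \<open>B\<^sup>*\<close> maps \<open>R(A)\<close> into itself. As \<open>B\<^sup>*\<close>
  is injective and the dimension is finite, so does its inverse \<open>B\<close>; in the monoid this is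
  \<open>P B P = B P\<close>, obtained from the \<open>\<pi>\<close>-regularity of \<open>B\<^sup>* P\<close> (\<open>invariant_under_inverse\<close>). The
  equations of a core inverse for \<open>B\<^sup>* X\<close> follow. In the second claim the inclusion
  \<open>R(A) \<subseteq> R(B)\<close> with \<open>A\<close> unitary forces \<open>B\<close> to be invertible, and core inverses of invertible
  elements are inverses.
\<close>

section \<open>Core inverses in a strongly \<pi>-regular monoid with proper involution\<close>

text \<open>The type of elements carries no further structure; the assumption \<open>proper\<close> is the
  cancellation law for \<open>a\<^sup>* a\<close>, stated without subtraction.\<close>

locale proper_star_monoid = monoid G for G (structure) +
  fixes star :: "'a \<Rightarrow> 'a"
  assumes star_closed [simp]: "a \<in> carrier G \<Longrightarrow> star a \<in> carrier G"
    and star_star [simp]: "a \<in> carrier G \<Longrightarrow> star (star a) = a"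
    and star_mult: "\<lbrakk>a \<in> carrier G; b \<in> carrier G\<rbrakk> \<Longrightarrow> star (a \<otimes> b) = star b \<otimes> star a"
    and proper: "\<lbrakk>a \<in> carrier G; c \<in> carrier G; d \<in> carrier G;
                  star a \<otimes> (a \<otimes> c) = star a \<otimes> (a \<otimes> d)\<rbrakk> \<Longrightarrow> a \<otimes> c = a \<otimes> d"
    and pi_regular: "a \<in> carrier G \<Longrightarrow>
                  \<exists>m::nat. \<exists>s\<in>carrier G. a [^] m = a [^] Suc m \<otimes> s \<and> a \<otimes> s = s \<otimes> a"
begin

text \<open>The three defining equations of the core inverse \<open>x\<close> of \<open>a\<close>.\<close>

definition core_inv_of :: "'a \<Rightarrow> 'a \<Rightarrow> bool" where
  "core_inv_of a x \<longleftrightarrow> x \<in> carrier G \<and> star (a \<otimes> x) = a \<otimes> x \<and>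
     x \<otimes> (a \<otimes> a) = a \<and> a \<otimes> (x \<otimes> x) = x"

lemma star_one [simp]: "star \<one> = \<one>"
  by (metis l_one one_closed star_closed star_mult star_star)

lemma core_inv_inner:
  assumes "a \<in> carrier G" "core_inv_of a x"
  shows "a \<otimes> (x \<otimes> a) = a"
proof -
  have x: "x \<in> carrier G" "x \<otimes> (a \<otimes> a) = a" "a \<otimes> (x \<otimes> x) = x"
    using assms by (auto simp: core_inv_of_def)
  have "a \<otimes> (x \<otimes> a) = a \<otimes> (x \<otimes> (x \<otimes> (a \<otimes> a)))" using x by simp
  also have "\<dots> = (a \<otimes> (x \<otimes> x)) \<otimes> (a \<otimes> a)" using x(1) assms(1) by (simp add: m_assoc)
  finally show ?thesis using x by simp
qed

lemma core_inv_outer: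
  assumes "a \<in> carrier G" "core_inv_of a x" "core_inv_of a y"
  shows "x \<otimes> (a \<otimes> y) = y"
proof -
  have x: "x \<in> carrier G" "x \<otimes> (a \<otimes> a) = a"
    and y: "y \<in> carrier G" "a \<otimes> (y \<otimes> y) = y"
    using assms by (auto simp: core_inv_of_def)
  have "x \<otimes> (a \<otimes> y) = x \<otimes> (a \<otimes> (a \<otimes> (y \<otimes> y)))" using y by simp
  also have "\<dots> = (x \<otimes> (a \<otimes> a)) \<otimes> (y \<otimes> y)" using x(1) y(1) assms(1) by (simp add: m_assoc)
  finally show ?thesis using x y by simp
qed

lemma core_inv_unique:
  assumes a: "a \<in> carrier G" and x: "core_inv_of a x" and y: "core_inv_of a y"
  shows "x = y"
proof -
  have c: "x \<in> carrier G" "y \<in> carrier G"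
    and h: "star (a \<otimes> x) = a \<otimes> x" "star (a \<otimes> y) = a \<otimes> y"
    using x y by (auto simp: core_inv_of_def)
  have xy: "(a \<otimes> x) \<otimes> (a \<otimes> y) = a \<otimes> y" and yx: "(a \<otimes> y) \<otimes> (a \<otimes> x) = a \<otimes> x"
    using core_inv_outer[OF a x y] core_inv_outer[OF a y x] a c by (simp_all add: m_assoc)
  \<comment> \<open>Both \<open>a x\<close> and \<open>a y\<close> are the orthogonal projection onto the range of \<open>a\<close>.\<close>
  have "a \<otimes> x = star ((a \<otimes> x) \<otimes> (a \<otimes> y))"
    using star_mult[of "a \<otimes> x" "a \<otimes> y"] h yx a c by simp
  then have "a \<otimes> x = a \<otimes> y" using xy h by simp
  then show ?thesis using core_inv_outer[OF a x x] core_inv_outer[OF a x y] by metis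
qed

text \<open>Existence of the group inverse, in the form of one-sided divisibility by \<open>a\<^sup>2\<close>:
  iterating \<open>a = a\<^sup>2 y\<close> brings \<open>a\<^sup>m\<close> into play, and \<open>\<pi>\<close>-regularity trades the right factor \<open>y\<close> for
  a factor \<open>s\<close> that commutes with \<open>a\<close>.\<close>

lemma square_divides_left:
  assumes a: "a \<in> carrier G" and y: "y \<in> carrier G" and eq: "a = a \<otimes> a \<otimes> y"
  obtains s where "s \<in> carrier G" "a \<otimes> s = s \<otimes> a" "a = s \<otimes> (a \<otimes> a)"
proof -
  obtain m :: nat and s where s: "s \<in> carrier G" "a [^] m = a [^] Suc m \<otimes> s" "a \<otimes> s = s \<otimes> a"
    using pi_regular[OF a] by blast
  have it: "a = a [^] Suc k \<otimes> y [^] k" for k :: nat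
  proof (induction k)
    case 0 show ?case using a by simp
  next
    case (Suc k)
    have "a [^] Suc (Suc k) \<otimes> y [^] Suc k = a [^] k \<otimes> (a \<otimes> a \<otimes> y) \<otimes> y [^] k"
      using a y by (subst nat_pow_Suc2[OF y]) (simp add: m_assoc)
    also have "\<dots> = a [^] Suc k \<otimes> y [^] k" by (simp add: eq[symmetric])
    finally show ?case by (rule trans[OF Suc sym])
  qed
  have comm: "a [^] k \<otimes> s = s \<otimes> a [^] k" for k :: nat
  proof (induction k)
    case (Suc k)
    have "a [^] Suc k \<otimes> s = a [^] k \<otimes> s \<otimes> a" using a s by (simp add: m_assoc)
    then show ?case using Suc a s by (simp add: m_assoc)
  qed (use s in simp)
  have "a = a [^] Suc m \<otimes> y [^] m" by (rule it)
  also have "\<dots> = a \<otimes> (a [^] m \<otimes> y [^] m)"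
    using a y(1) by (simp add: nat_pow_Suc2 m_assoc del: nat_pow_Suc Group.nat_pow_Suc)
  also have "a [^] m = s \<otimes> a [^] Suc m" using s(2) comm[of "Suc m"] by (rule trans)
  also have "a \<otimes> (s \<otimes> a [^] Suc m \<otimes> y [^] m) = a \<otimes> (s \<otimes> (a [^] Suc m \<otimes> y [^] m))"
    using a y(1) s(1) by (simp add: m_assoc)
  also have "\<dots> = a \<otimes> (s \<otimes> a)" by (simp only: it[of m, symmetric])
  also have "\<dots> = s \<otimes> (a \<otimes> a)" using a s(1,3) by (metis m_assoc)
  finally show ?thesis using that s(1,3) by blast
qed

text \<open>The orthogonal projection onto the range of \<open>a\<close>; \<open>s\<close> inverts \<open>a\<^sup>* a\<close> on its own range, and
  the projection is \<open>a s a\<^sup>*\<close>.\<close>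

lemma range_projection:
  assumes a: "a \<in> carrier G"
  obtains w where "w \<in> carrier G" "star (a \<otimes> w) = a \<otimes> w" "a \<otimes> w \<otimes> a = a"
proof -
  define h where "h = star a \<otimes> a"
  have h: "h \<in> carrier G" "star h = h" using a by (simp_all add: h_def star_mult)
  obtain m :: nat and s where s: "s \<in> carrier G" "h [^] m = h [^] Suc m \<otimes> s" "h \<otimes> s = s \<otimes> h"
    using pi_regular[OF h(1)] by blast
  have "h [^] Suc k = h [^] Suc k \<otimes> (s \<otimes> h) \<Longrightarrow> h = h \<otimes> (s \<otimes> h)" for k :: nat
  proof (induction k)
    case 0
    then show ?case using h(1) by (metis nat_pow_Suc nat_pow_0 l_one)
  next
    case (Suc k)
    have "star h \<otimes> (h \<otimes> h [^] k) = star h \<otimes> (h \<otimes> (h [^] k \<otimes> (s \<otimes> h)))"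
      using Suc.prems h s(1) by (simp add: nat_pow_Suc2 m_assoc del: nat_pow_Suc Group.nat_pow_Suc)
    then have "h \<otimes> h [^] k = h \<otimes> (h [^] k \<otimes> (s \<otimes> h))"
      using h(1) s(1) by (intro proper[OF h(1)]) simp_all
    then have "h [^] Suc k = h [^] Suc k \<otimes> (s \<otimes> h)"
      using h(1) s(1) by (metis nat_pow_Suc2 m_assoc m_closed nat_pow_closed)
    then show ?case by (rule Suc.IH)
  qed
  moreover have "h [^] Suc m = h [^] Suc m \<otimes> (s \<otimes> h)"
  proof -
    have "h [^] Suc m = h [^] Suc m \<otimes> s \<otimes> h" using s(2) by (metis nat_pow_Suc)
    also have "\<dots> = h [^] Suc m \<otimes> (s \<otimes> h)" using h(1) s(1) by (simp add: m_assoc)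
    finally show ?thesis .
  qed
  ultimately have hd: "h = h \<otimes> (s \<otimes> h)" by blast
  have "star a \<otimes> (a \<otimes> \<one>) = h" using a by (simp add: h_def)
  also note hd
  also have "h \<otimes> (s \<otimes> h) = star a \<otimes> (a \<otimes> (s \<otimes> h))"
    using a s(1) h(1) by (subst (1) h_def) (simp add: m_assoc)
  finally have "star a \<otimes> (a \<otimes> \<one>) = star a \<otimes> (a \<otimes> (s \<otimes> h))" .
  then have "a \<otimes> \<one> = a \<otimes> (s \<otimes> h)"
    using proper[OF a one_closed, of "s \<otimes> h"] s(1) h(1) by simp
  moreover have "a \<otimes> (s \<otimes> star a) \<otimes> a = a \<otimes> (s \<otimes> h)" using a s(1) by (simp add: h_def m_assoc)
  ultimately have e1: "a \<otimes> (s \<otimes> star a) \<otimes> a = a" using a by (metis r_one)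
  define e where "e = a \<otimes> (s \<otimes> star a)"
  have e: "e \<in> carrier G" "e \<otimes> a = a" using a s(1) e1 by (simp_all add: e_def)
  have "star a \<otimes> star e = star a" using star_mult[of e a] a e by simp
  then have ee: "e \<otimes> star e = e"
    using a s(1) e(1) by (simp add: e_def m_assoc)
  have "star (e \<otimes> star e) = e \<otimes> star e" using e by (simp add: star_mult)
  then have "star e = e" using ee by simp
  then show ?thesis using that[of "s \<otimes> star a"] e a s(1) by (simp add: e_def)
qed

text \<open>With \<open>e\<close> the projection onto the range of \<open>a\<close> and \<open>s\<close> an inverse of \<open>a\<close> on that range, the core
  inverse is \<open>s e\<close>.\<close>

lemma core_inv_exists:
  assumes a: "a \<in> carrier G" and y: "y \<in> carrier G" "a = a \<otimes> a \<otimes> y"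
  obtains x where "core_inv_of a x"
proof -
  obtain s where s: "s \<in> carrier G" "a \<otimes> s = s \<otimes> a" "a = s \<otimes> (a \<otimes> a)"
    using square_divides_left[OF a y] .
  obtain w where w: "w \<in> carrier G" "star (a \<otimes> w) = a \<otimes> w" "a \<otimes> w \<otimes> a = a"
    using range_projection[OF a] .
  define e where "e = a \<otimes> w"
  have e: "e \<in> carrier G" "star e = e" "e \<otimes> a = a" using a w by (simp_all add: e_def)
  have asa: "a \<otimes> s \<otimes> a = a" using a s by (metis m_assoc)
  have ax: "a \<otimes> (s \<otimes> e) = e"
  proof -
    have "a \<otimes> (s \<otimes> e) = a \<otimes> s \<otimes> a \<otimes> w" using a s(1) w(1) by (simp add: e_def m_assoc)
    then show ?thesis by (simp add: asa e_def)
  qed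
  have "s \<otimes> e \<otimes> (a \<otimes> a) = s \<otimes> (e \<otimes> a \<otimes> a)" using a s(1) e(1) by (simp add: m_assoc)
  then have xaa: "s \<otimes> e \<otimes> (a \<otimes> a) = a" by (simp add: e(3) s(3)[symmetric])
  have se: "s \<otimes> e = a \<otimes> s \<otimes> w" using a s(1,2) w(1) by (simp add: e_def m_assoc[symmetric])
  have "a \<otimes> (s \<otimes> e \<otimes> (s \<otimes> e)) = a \<otimes> (s \<otimes> e) \<otimes> (s \<otimes> e)"
    using a s(1) e(1) by (simp add: m_assoc)
  also have "\<dots> = e \<otimes> (a \<otimes> s \<otimes> w)" by (simp add: ax se[symmetric])
  also have "\<dots> = e \<otimes> a \<otimes> s \<otimes> w" using a s(1) w(1) e(1) by (simp add: m_assoc)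
  also have "\<dots> = s \<otimes> e" using e se by simp
  finally have "core_inv_of a (s \<otimes> e)"
    using ax xaa e s(1) by (simp add: core_inv_of_def)
  then show ?thesis using that by blast
qed

text \<open>If \<open>u\<close> is invertible and maps the range of the idempotent \<open>p\<close> into itself, then so does the
  inverse \<open>b\<close> of \<open>u\<close>. With \<open>q = u p\<close> one has \<open>b\<^sup>m q\<^sup>m p = p\<close>, so that cancelling \<open>q\<^sup>m\<close> in
  \<open>q\<^sup>m p = q\<^sup>m (q s p)\<close> gives \<open>p = q s p\<close>, which shows that \<open>q\<close> is onto the range of \<open>p\<close>.\<close>

lemma invariant_under_inverse:
  assumes c: "p \<in> carrier G" "u \<in> carrier G" "b \<in> carrier G"
    and pp: "p \<otimes> p = p" and bu: "b \<otimes> u = \<one>" and inv: "p \<otimes> (u \<otimes> p) = u \<otimes> p"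
  shows "p \<otimes> (b \<otimes> p) = b \<otimes> p"
proof -
  define q where "q = u \<otimes> p"
  have q: "q \<in> carrier G" "p \<otimes> q = q" using c inv by (simp_all add: q_def)
  have bq: "b \<otimes> q = p" using c bu by (simp add: q_def m_assoc[symmetric])
  obtain m :: nat and s where s: "s \<in> carrier G" "q [^] m = q [^] Suc m \<otimes> s"
    using pi_regular[OF q(1)] by blast
  have pqp: "p \<otimes> (q [^] k \<otimes> p) = q [^] k \<otimes> p" for k :: nat
  proof (cases k)
    case (Suc j)
    have "p \<otimes> (q \<otimes> q [^] j \<otimes> p) = p \<otimes> q \<otimes> q [^] j \<otimes> p" using c q(1) by (simp add: m_assoc)
    then show ?thesis using q Suc by (simp add: nat_pow_Suc2 del: nat_pow_Suc Group.nat_pow_Suc)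
  qed (use c pp in simp)
  have bqp: "b [^] k \<otimes> (q [^] k \<otimes> p) = p" for k :: nat
  proof (induction k)
    case (Suc k)
    have "b [^] Suc k \<otimes> (q [^] Suc k \<otimes> p) = b [^] k \<otimes> (b \<otimes> q \<otimes> (q [^] k \<otimes> p))"
      using c q(1) by (subst nat_pow_Suc2[OF q(1)]) (simp add: m_assoc)
    then show ?case using Suc bq pqp by simp
  qed (use c in simp)
  have "q [^] m \<otimes> p = q [^] Suc m \<otimes> s \<otimes> p"
    by (rule arg_cong[OF s(2), where f = "\<lambda>z. z \<otimes> p"])
  also have "\<dots> = q [^] m \<otimes> (q \<otimes> s \<otimes> p)" using c q(1) s(1) by (simp add: m_assoc)
  finally have qm: "q [^] m \<otimes> p = q [^] m \<otimes> (q \<otimes> s \<otimes> p)" .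
  have "p = b [^] m \<otimes> (q [^] m \<otimes> p)" by (rule bqp[symmetric])
  also have "\<dots> = b [^] m \<otimes> (q [^] m \<otimes> (q \<otimes> s \<otimes> p))" by (simp only: qm)
  also have "\<dots> = b [^] m \<otimes> (q [^] m \<otimes> (p \<otimes> q \<otimes> s \<otimes> p))" by (simp add: q)
  also have "\<dots> = b [^] m \<otimes> (q [^] m \<otimes> p) \<otimes> (q \<otimes> s \<otimes> p)"
    using c q(1) s(1) by (simp add: m_assoc)
  also have "\<dots> = p \<otimes> q \<otimes> s \<otimes> p" using bqp c q(1) s(1) by (simp add: m_assoc)
  also have "\<dots> = q \<otimes> (s \<otimes> p)" using c q s(1) by (simp add: m_assoc)
  finally have p: "p = q \<otimes> (s \<otimes> p)" .
  \<comment> \<open>Hence \<open>b\<close> maps the range of \<open>p\<close> into that of \<open>b q = p\<close>.\<close>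
  have "b \<otimes> p = b \<otimes> q \<otimes> (s \<otimes> p)" using p c q(1) s(1) by (metis m_assoc m_closed)
  then have "b \<otimes> p = p \<otimes> (s \<otimes> p)" by (simp add: bq)
  then show ?thesis using c s(1) pp by (metis m_assoc m_closed)
qed

text \<open>The hypothesis \<open>u x = x y\<close> says that \<open>u\<close> maps the range of \<open>x\<close>, which is that of \<open>a\<close>, into
  itself. For unitary \<open>b\<close> the inverse \<open>u\<close> is \<open>b\<^sup>*\<close>, but only invertibility matters, since
  \<open>a b (u x) = a x\<close> is self-adjoint in any case.\<close>

lemma core_inv_mult_invertible_right:
  assumes c: "a \<in> carrier G" "b \<in> carrier G" "u \<in> carrier G" "y \<in> carrier G"
    and bu: "b \<otimes> u = \<one>" and ub: "u \<otimes> b = \<one>"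
    and core: "core_inv_of a x" and ux: "u \<otimes> x = x \<otimes> y"
  shows "core_inv_of (a \<otimes> b) (u \<otimes> x)"
proof -
  have x: "x \<in> carrier G" "star (a \<otimes> x) = a \<otimes> x" "x \<otimes> (a \<otimes> a) = a" "a \<otimes> (x \<otimes> x) = x"
    using core by (auto simp: core_inv_of_def)
  define p where "p = a \<otimes> x"
  have p: "p \<in> carrier G" "p \<otimes> x = x" "p \<otimes> a = a"
    using c x core_inv_inner[OF c(1) core] by (simp_all add: p_def m_assoc)
  have pp: "p \<otimes> p = p"
  proof -
    have "p \<otimes> p = p \<otimes> a \<otimes> x"
      using p(1) c x(1) by (subst (2) p_def) (simp add: m_assoc)
    then show ?thesis using p(3) by (simp add: p_def)
  qed
  have pux: "p \<otimes> (u \<otimes> x) = u \<otimes> x" using p x(1) c ux by (simp add: m_assoc[symmetric])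
  \<comment> \<open>The ranges of \<open>p\<close> and \<open>x\<close> agree.\<close>
  have px: "p = x \<otimes> (a \<otimes> a \<otimes> x)" using x c by (simp add: p_def m_assoc[symmetric])
  have "p \<otimes> (u \<otimes> p) = p \<otimes> (u \<otimes> x) \<otimes> (a \<otimes> a \<otimes> x)"
    using p(1) c x(1) by (subst (2) px) (simp add: m_assoc)
  also have "\<dots> = u \<otimes> x \<otimes> (a \<otimes> a \<otimes> x)" by (simp add: pux)
  also have "\<dots> = u \<otimes> p" using c x(1) by (subst px) (simp add: m_assoc)
  finally have pbp: "p \<otimes> (b \<otimes> p) = b \<otimes> p"
    using invariant_under_inverse[OF p(1) c(3,2) pp bu] by simp
  have "p \<otimes> (b \<otimes> a) = p \<otimes> (b \<otimes> p) \<otimes> a" using p c by (simp add: m_assoc)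
  also have "\<dots> = b \<otimes> a" unfolding pbp using p c by (simp add: m_assoc)
  finally have pba: "p \<otimes> (b \<otimes> a) = b \<otimes> a" .
  have mx: "a \<otimes> b \<otimes> (u \<otimes> x) = p"
  proof -
    have "a \<otimes> b \<otimes> (u \<otimes> x) = a \<otimes> (b \<otimes> u) \<otimes> x" using c x(1) by (simp add: m_assoc)
    then show ?thesis using bu c by (simp add: p_def)
  qed
  have xap: "x \<otimes> (a \<otimes> p) = p" using px c x(1) by (simp add: p_def m_assoc)
  have "u \<otimes> x \<otimes> (a \<otimes> b \<otimes> (a \<otimes> b)) = u \<otimes> (x \<otimes> (a \<otimes> (b \<otimes> a))) \<otimes> b"
    using c x(1) by (simp add: m_assoc)
  also have "x \<otimes> (a \<otimes> (b \<otimes> a)) = x \<otimes> (a \<otimes> p) \<otimes> (b \<otimes> a)"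
    by (subst pba[symmetric]) (use c x(1) p(1) in \<open>simp add: m_assoc\<close>)
  also have "\<dots> = b \<otimes> a" by (simp add: xap pba)
  also have "u \<otimes> (b \<otimes> a) \<otimes> b = u \<otimes> b \<otimes> (a \<otimes> b)" using c by (simp add: m_assoc)
  finally have xmm: "u \<otimes> x \<otimes> (a \<otimes> b \<otimes> (a \<otimes> b)) = a \<otimes> b" using ub c by simp
  have "a \<otimes> b \<otimes> (u \<otimes> x \<otimes> (u \<otimes> x)) = a \<otimes> b \<otimes> (u \<otimes> x) \<otimes> (u \<otimes> x)"
    using c x(1) by (simp add: m_assoc)
  also have "\<dots> = u \<otimes> x" by (simp add: mx pux)
  finally show ?thesis
    using mx xmm x(1,2) c by (simp add: core_inv_of_def p_def)
qed

lemma right_inverse_imp_left_inverse: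
  assumes b: "b \<in> carrier G" "w \<in> carrier G" "b \<otimes> w = \<one>"
  shows "w \<otimes> b = \<one>"
proof -
  have "b = b \<otimes> b \<otimes> w" using b by (simp add: m_assoc)
  then obtain y where y: "y \<in> carrier G" "y \<otimes> (b \<otimes> b) = b"
    using square_divides_left[OF b(1,2)] by metis
  have "y \<otimes> b = y \<otimes> (b \<otimes> b) \<otimes> w" using b y(1) by (simp add: m_assoc)
  then have "y \<otimes> b = \<one>" using b y by simp
  moreover from this have "w = y"
    using b y(1) by (metis m_assoc l_one r_one)
  ultimately show ?thesis by simp
qed

lemma core_inv_of_inverse:
  assumes "a \<in> carrier G" "x \<in> carrier G" "a \<otimes> x = \<one>" "x \<otimes> a = \<one>"
  shows "core_inv_of a x"
  using assms by (simp add: core_inv_of_def m_assoc[symmetric])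

end

section \<open>Nontrivial solutions of homogeneous linear systems\<close>

lemma homogeneous_system_nontrivial:
  fixes a :: "'e \<Rightarrow> 'u \<Rightarrow> 'f::field"
  assumes "finite E" "finite U" "card E < card U"
  shows "\<exists>x. (\<exists>u\<in>U. x u \<noteq> 0) \<and> (\<forall>e\<in>E. (\<Sum>u\<in>U. a e u * x u) = 0)"
  using assms
proof (induction E arbitrary: U a rule: finite_induct)
  case empty
  then have "U \<noteq> {}" by auto
  then show ?case by (intro exI[of _ "\<lambda>_. 1"]) auto
next
  case (insert e E)
  show ?case
  proof (cases "\<forall>u\<in>U. a e u = 0")
    case True
    obtain x where "\<exists>u\<in>U. x u \<noteq> 0" "\<forall>e\<in>E. (\<Sum>u\<in>U. a e u * x u) = 0"
      using insert.IH[of U a] insert.prems insert.hyps by auto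
    then show ?thesis using True by (intro exI[of _ x]) auto
  next
    case False
    \<comment> \<open>Eliminate the unknown \<open>v\<close> by means of the equation \<open>e\<close>.\<close>
    then obtain v where v: "v \<in> U" "a e v \<noteq> 0" by blast
    define V where "V = U - {v}"
    have V: "finite V" "U = insert v V" "v \<notin> V" using insert.prems v by (auto simp: V_def)
    have "card E < card V" using insert V by simp
    then obtain x where x: "\<exists>u\<in>V. x u \<noteq> 0"
      "\<forall>d\<in>E. (\<Sum>u\<in>V. (a d u - a d v * a e u / a e v) * x u) = 0"
      using insert.IH[of V "\<lambda>d u. a d u - a d v * a e u / a e v"] V(1) by auto
    define t where "t = - (\<Sum>u\<in>V. a e u * x u) / a e v"
    have split: "(\<Sum>u\<in>U. a d u * (x(v := t)) u) = a d v * t + (\<Sum>u\<in>V. a d u * x u)" for d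
    proof -
      have "(\<Sum>u\<in>V. a d u * (x(v := t)) u) = (\<Sum>u\<in>V. a d u * x u)"
        using V(3) by (intro sum.cong) auto
      then show ?thesis using V by simp
    qed
    have "a d v * t + (\<Sum>u\<in>V. a d u * x u) = 0" if "d \<in> E" for d
    proof -
      have "0 = (\<Sum>u\<in>V. a d u * x u - a d v / a e v * (a e u * x u))"
        using x(2) that by (simp add: left_diff_distrib mult.assoc)
      also have "\<dots> = (\<Sum>u\<in>V. a d u * x u) - a d v / a e v * (\<Sum>u\<in>V. a e u * x u)"
        by (simp add: sum_subtractf sum_distrib_left)
      finally show ?thesis by (simp add: t_def)
    qed
    moreover have "a e v * t + (\<Sum>u\<in>V. a e u * x u) = 0" using v by (simp add: t_def)
    moreover have "\<exists>u\<in>U. (x(v := t)) u \<noteq> 0" using x(1) V by auto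
    ultimately show ?thesis by (intro exI[of _ "x(v := t)"]) (simp only: split, auto)
  qed
qed

section \<open>The monoid of square tensors\<close>

lemma finite_mindices [simp]: "finite (mindices n N)"
  by (simp add: mindices_def finite_PiE)

lemma tensors_eqI:
  assumes "A \<in> tensors n N" "B \<in> tensors n N"
    and "\<And>i j. \<lbrakk>i \<in> mindices n N; j \<in> mindices n N\<rbrakk> \<Longrightarrow> A i j = B i j"
  shows "A = B"
proof (rule PiE_ext)
  fix i assume i: "i \<in> mindices n N"
  show "A i = B i"
    by (rule PiE_ext[where k = "mindices n N" and s = "\<lambda>_. UNIV"])
       (use assms i in \<open>auto simp: tensors_def\<close>)
qed (use assms in \<open>auto simp: tensors_def\<close>)

lemma einstein_closed [simp]: "einstein n N A B \<in> tensors n N"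
  by (auto simp: einstein_def tensors_def)

lemma tensor_id_closed [simp]: "tensor_id n N \<in> tensors n N"
  by (auto simp: tensor_id_def tensors_def)

lemma tensor_adj_closed [simp]: "tensor_adj n N A \<in> tensors n N"
  by (auto simp: tensor_adj_def tensors_def)

lemma einstein_assoc:
  "einstein n N (einstein n N A B) C = einstein n N A (einstein n N B C)"
proof (rule tensors_eqI)
  fix i j assume "i \<in> mindices n N" "j \<in> mindices n N"
  then have "einstein n N (einstein n N A B) C i j
      = (\<Sum>k\<in>mindices n N. \<Sum>l\<in>mindices n N. A i l * B l k * C k j)"
    by (simp add: einstein_def sum_distrib_right)
  also have "\<dots> = (\<Sum>l\<in>mindices n N. \<Sum>k\<in>mindices n N. A i l * B l k * C k j)"
    by (rule sum.swap)
  also have "\<dots> = einstein n N A (einstein n N B C) i j"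
    using \<open>i \<in> _\<close> \<open>j \<in> _\<close> by (simp add: einstein_def sum_distrib_left mult.assoc)
  finally show "einstein n N (einstein n N A B) C i j = einstein n N A (einstein n N B C) i j" .
qed simp_all

text \<open>The square tensors under the Einstein product, packaged as a monoid record. The carrier consists
  of extensional functions, so its identity and associativity laws are equalities of HOL functions.\<close>

definition tensor_monoid :: "nat \<Rightarrow> (nat \<Rightarrow> nat) \<Rightarrow> tensor monoid" where
  "tensor_monoid n N =
     \<lparr>carrier = tensors n N, monoid.mult = einstein n N, one = tensor_id n N\<rparr>"

lemma tensor_monoid_simps [simp]:
  "carrier (tensor_monoid n N) = tensors n N"
  "monoid.mult (tensor_monoid n N) = einstein n N"
  "one (tensor_monoid n N) = tensor_id n N"
  by (simp_all add: tensor_monoid_def)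

lemma einstein_id_left:
  assumes "A \<in> tensors n N"
  shows "einstein n N (tensor_id n N) A = A"
proof (rule tensors_eqI)
  fix i j assume "i \<in> mindices n N" "j \<in> mindices n N"
  then show "einstein n N (tensor_id n N) A i j = A i j"
    by (simp add: einstein_def tensor_id_def if_distrib[of "\<lambda>x. x * _"] cong: if_cong)
qed (use assms in simp_all)

lemma einstein_id_right:
  assumes "A \<in> tensors n N"
  shows "einstein n N A (tensor_id n N) = A"
proof (rule tensors_eqI)
  fix i j assume "i \<in> mindices n N" "j \<in> mindices n N"
  then show "einstein n N A (tensor_id n N) i j = A i j"
    by (simp add: einstein_def tensor_id_def if_distrib[of "\<lambda>x. _ * x"] cong: if_cong)
qed (use assms in simp_all)

lemma monoid_tensor_monoid: "monoid (tensor_monoid n N)"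
  by (rule monoidI) (simp_all add: einstein_assoc einstein_id_left einstein_id_right)

lemma tensor_adj_adj:
  assumes "A \<in> tensors n N"
  shows "tensor_adj n N (tensor_adj n N A) = A"
proof (rule tensors_eqI)
  fix i j assume "i \<in> mindices n N" "j \<in> mindices n N"
  then show "tensor_adj n N (tensor_adj n N A) i j = A i j" by (simp add: tensor_adj_def)
qed (use assms in simp_all)

lemma tensor_adj_einstein:
  "tensor_adj n N (einstein n N A B) = einstein n N (tensor_adj n N B) (tensor_adj n N A)"
proof (rule tensors_eqI)
  fix i j assume "i \<in> mindices n N" "j \<in> mindices n N"
  then show "tensor_adj n N (einstein n N A B) i j
      = einstein n N (tensor_adj n N B) (tensor_adj n N A) i j"
    by (simp add: tensor_adj_def einstein_def mult.commute)
qed simp_all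

text \<open>Column by column: for \<open>z\<close> the difference of the columns of \<open>C\<close> and \<open>D\<close> and \<open>w = A z\<close>, the
  hypothesis reads \<open>A\<^sup>* w = 0\<close>, whence \<open>\<parallel>w\<parallel>\<^sup>2 = \<langle>z, A\<^sup>* w\<rangle> = 0\<close>.\<close>

lemma tensor_adj_proper:
  assumes "einstein n N (tensor_adj n N A) (einstein n N A C)
         = einstein n N (tensor_adj n N A) (einstein n N A D)"
  shows "einstein n N A C = einstein n N A D"
proof (rule tensors_eqI)
  fix i j assume ij: "i \<in> mindices n N" "j \<in> mindices n N"
  let ?I = "mindices n N"
  define z where "z k = C k j - D k j" for k
  define w where "w i = (\<Sum>k\<in>?I. A i k * z k)" for i
  have w: "einstein n N A C i j - einstein n N A D i j = w i" if "i \<in> ?I" for i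
    using that ij by (simp add: einstein_def w_def z_def right_diff_distrib sum_subtractf)
  have adj: "(\<Sum>i\<in>?I. cnj (A i k) * w i) = 0" if k: "k \<in> ?I" for k
  proof -
    have "(\<Sum>i\<in>?I. cnj (A i k) * w i)
        = (\<Sum>i\<in>?I. cnj (A i k) * (einstein n N A C i j - einstein n N A D i j))"
      by (simp add: w)
    also have "\<dots> = einstein n N (tensor_adj n N A) (einstein n N A C) k j
        - einstein n N (tensor_adj n N A) (einstein n N A D) k j"
      using k ij by (subst (3 4) einstein_def)
        (simp add: tensor_adj_def right_diff_distrib sum_subtractf)
    finally show ?thesis by (simp add: assms)
  qed
  have "complex_of_real (\<Sum>i\<in>?I. (cmod (w i))\<^sup>2) = (\<Sum>i\<in>?I. cnj (w i) * w i)"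
    by (simp add: complex_norm_square mult.commute del: of_real_power)
  also have "\<dots> = (\<Sum>i\<in>?I. \<Sum>k\<in>?I. cnj (z k) * (cnj (A i k) * w i))"
    by (subst w_def) (simp add: sum_distrib_right sum_distrib_left mult_ac)
  also have "\<dots> = (\<Sum>k\<in>?I. \<Sum>i\<in>?I. cnj (z k) * (cnj (A i k) * w i))"
    by (rule sum.swap)
  also have "\<dots> = 0" by (simp add: sum_distrib_left[symmetric] adj)
  finally have "(\<Sum>i\<in>?I. (cmod (w i))\<^sup>2) = 0" using of_real_eq_0_iff by blast
  then have "w i = 0" using ij by (simp add: sum_nonneg_eq_0_iff)
  then show "einstein n N A C i j = einstein n N A D i j" using w[OF ij(1)] by simp
qed simp_all

lemma tensor_pow_closed [simp]: "tensor_pow n N A k \<in> tensors n N"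
  by (cases k) simp_all

lemma tensor_pow_eq_nat_pow:
  assumes "A \<in> tensors n N"
  shows "tensor_pow n N A k = A [^]\<^bsub>tensor_monoid n N\<^esub> k"
proof -
  interpret monoid "tensor_monoid n N" by (rule monoid_tensor_monoid)
  show ?thesis
  proof (induction k)
    case (Suc k)
    have "A [^]\<^bsub>tensor_monoid n N\<^esub> Suc k = einstein n N A (A [^]\<^bsub>tensor_monoid n N\<^esub> k)"
      using nat_pow_Suc2[of A k] assms by simp
    then show ?case using Suc by simp
  qed simp
qed

lemma tensor_pow_Suc_right:
  assumes "A \<in> tensors n N"
  shows "tensor_pow n N A (Suc k) = einstein n N (tensor_pow n N A k) A"
  using assms by (simp only: tensor_pow_eq_nat_pow nat_pow_Suc tensor_monoid_simps)

lemma tensor_pow_add: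
  assumes "A \<in> tensors n N"
  shows "einstein n N (tensor_pow n N A k) (tensor_pow n N A l) = tensor_pow n N A (k + l)"
  using monoid.nat_pow_mult[OF monoid_tensor_monoid, of A n N k l] assms
  by (simp add: tensor_pow_eq_nat_pow)

text \<open>The powers \<open>A\<^sup>0, \<dots>, A\<^sup>d\<close> with \<open>d = (N\<^sub>1 \<cdots> N\<^sub>n)\<^sup>2\<close> satisfy a nontrivial linear relation. Solving it
  for the lowest power \<open>A\<^sup>m\<close> that occurs gives \<open>A\<^sup>m = A\<^sup>m\<^sup>+\<^sup>1 S\<close> with \<open>S\<close> a polynomial in \<open>A\<close>.\<close>

lemma tensor_pi_regular:
  assumes A: "A \<in> tensors n N"
  shows "\<exists>m. \<exists>S\<in>tensors n N.
    tensor_pow n N A m = einstein n N (tensor_pow n N A (Suc m)) S \<and>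
    einstein n N A S = einstein n N S A"
proof -
  let ?I = "mindices n N" and ?P = "tensor_pow n N A"
  define d where "d = card (?I \<times> ?I)"
  obtain c where c: "\<exists>k\<in>{..d}. c k \<noteq> 0"
    "\<forall>e\<in>?I \<times> ?I. (\<Sum>k\<le>d. ?P k (fst e) (snd e) * c k) = 0"
    using homogeneous_system_nontrivial[of "?I \<times> ?I" "{..d}" "\<lambda>e k. ?P k (fst e) (snd e)"]
    by (auto simp: d_def)
  define m where "m = (LEAST k. k \<le> d \<and> c k \<noteq> 0)"
  have m: "m \<le> d" "c m \<noteq> 0"
    using LeastI_ex[of "\<lambda>k. k \<le> d \<and> c k \<noteq> 0"] c(1) by (auto simp: m_def)
  have low: "c k = 0" if "k < m" for k
    using not_less_Least[of k "\<lambda>k. k \<le> d \<and> c k \<noteq> 0"] that m by (auto simp: m_def)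
  define g where "g k = - c k / c m" for k
  define S where "S = (\<lambda>i\<in>?I. \<lambda>j\<in>?I. \<Sum>k\<in>{Suc m..d}. ?P (k - Suc m) i j * g k)"
  have S: "S \<in> tensors n N" by (auto simp: S_def tensors_def)
  have left: "einstein n N B S i j
      = (\<Sum>k\<in>{Suc m..d}. einstein n N B (?P (k - Suc m)) i j * g k)"
    if "i \<in> ?I" "j \<in> ?I" for B i j
  proof -
    have "einstein n N B S i j
        = (\<Sum>l\<in>?I. \<Sum>k\<in>{Suc m..d}. B i l * ?P (k - Suc m) l j * g k)"
      using that by (simp add: einstein_def S_def sum_distrib_left mult.assoc)
    also have "\<dots> = (\<Sum>k\<in>{Suc m..d}. \<Sum>l\<in>?I. B i l * ?P (k - Suc m) l j * g k)"
      by (rule sum.swap)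
    finally show ?thesis using that by (simp add: einstein_def sum_distrib_right)
  qed
  have right: "einstein n N S B i j
      = (\<Sum>k\<in>{Suc m..d}. einstein n N (?P (k - Suc m)) B i j * g k)"
    if "i \<in> ?I" "j \<in> ?I" for B i j
  proof -
    have "einstein n N S B i j
        = (\<Sum>l\<in>?I. \<Sum>k\<in>{Suc m..d}. ?P (k - Suc m) i l * B l j * g k)"
      using that by (simp add: einstein_def S_def sum_distrib_right sum_distrib_left mult_ac)
    also have "\<dots> = (\<Sum>k\<in>{Suc m..d}. \<Sum>l\<in>?I. ?P (k - Suc m) i l * B l j * g k)"
      by (rule sum.swap)
    finally show ?thesis using that by (simp add: einstein_def sum_distrib_right)
  qed
  have "?P m = einstein n N (?P (Suc m)) S"
  proof (rule tensors_eqI)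
    fix i j assume ij: "i \<in> ?I" "j \<in> ?I"
    have "0 = (\<Sum>k\<le>d. ?P k i j * c k)" using c(2) ij by auto
    also have "\<dots> = (\<Sum>k\<in>{m..d}. ?P k i j * c k)"
      by (rule sum.mono_neutral_right) (auto simp: low)
    also have "\<dots> = ?P m i j * c m + (\<Sum>k\<in>{Suc m..d}. ?P k i j * c k)"
      using m(1) by (rule sum.atLeast_Suc_atMost)
    finally have "?P m i j * c m = - (\<Sum>k\<in>{Suc m..d}. ?P k i j * c k)"
      by (simp add: eq_neg_iff_add_eq_0)
    then have "?P m i j = - (\<Sum>k\<in>{Suc m..d}. ?P k i j * c k) / c m"
      using m(2) by (metis nonzero_mult_div_cancel_right)
    also have "\<dots> = (\<Sum>k\<in>{Suc m..d}. ?P k i j * g k)"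
      by (simp add: g_def sum_divide_distrib sum_negf)
    also have "\<dots> = einstein n N (?P (Suc m)) S i j"
      unfolding left[OF ij]
      by (rule sum.cong) (simp_all add: tensor_pow_add[OF A] del: tensor_pow.simps)
    finally show "?P m i j = einstein n N (?P (Suc m)) S i j" .
  qed simp_all
  moreover have "einstein n N A S = einstein n N S A"
  proof (rule tensors_eqI)
    fix i j assume "i \<in> ?I" "j \<in> ?I"
    then show "einstein n N A S i j = einstein n N S A i j"
      by (simp add: left right tensor_pow_Suc_right[OF A, symmetric])
  qed simp_all
  ultimately show ?thesis using S by blast
qed

interpretation tensor: proper_star_monoid "tensor_monoid n N" "tensor_adj n N" for n N
proof -
  interpret monoid "tensor_monoid n N" by (rule monoid_tensor_monoid)
  show "proper_star_monoid (tensor_monoid n N) (tensor_adj n N)"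
  proof
    fix A assume A: "A \<in> carrier (tensor_monoid n N)"
    then show "\<exists>m::nat. \<exists>S\<in>carrier (tensor_monoid n N).
        A [^]\<^bsub>tensor_monoid n N\<^esub> m
          = A [^]\<^bsub>tensor_monoid n N\<^esub> Suc m \<otimes>\<^bsub>tensor_monoid n N\<^esub> S \<and>
        A \<otimes>\<^bsub>tensor_monoid n N\<^esub> S = S \<otimes>\<^bsub>tensor_monoid n N\<^esub> A"
      using tensor_pi_regular[of A n N] tensor_pow_eq_nat_pow[of A n N]
      by (simp del: tensor_pow.simps nat_pow_Suc)
  qed (auto simp: tensor_adj_adj tensor_adj_einstein intro: tensor_adj_proper)
qed

section \<open>Ranges, index and core inverses of tensors\<close>

lemma einstein_vec_closed [simp]: "einstein_vec n N A v \<in> vtensors n N"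
  by (auto simp: einstein_vec_def vtensors_def)

lemma einstein_vec_einstein:
  "einstein_vec n N (einstein n N A B) v = einstein_vec n N A (einstein_vec n N B v)"
proof (rule ext)
  fix i
  let ?I = "mindices n N"
  have "(\<Sum>k\<in>?I. (\<Sum>l\<in>?I. A i l * B l k) * v k) = (\<Sum>l\<in>?I. A i l * (\<Sum>k\<in>?I. B l k * v k))"
    by (simp add: sum_distrib_left sum_distrib_right mult.assoc) (rule sum.swap)
  then show "einstein_vec n N (einstein n N A B) v i
      = einstein_vec n N A (einstein_vec n N B v) i"
    by (cases "i \<in> ?I") (simp_all add: einstein_vec_def einstein_def)
qed

lemma tensor_range_einstein_subset: "tensor_range n N (einstein n N A B) \<subseteq> tensor_range n N A"
  by (auto simp: tensor_range_def einstein_vec_einstein)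

lemma tensor_range_subset_imp_factor:
  assumes A: "A \<in> tensors n N" and sub: "tensor_range n N A \<subseteq> tensor_range n N B"
  obtains Y where "Y \<in> tensors n N" "A = einstein n N B Y"
proof -
  let ?I = "mindices n N"
  have "\<exists>v. \<forall>i\<in>?I. A i j = (\<Sum>k\<in>?I. B i k * v k)" if j: "j \<in> ?I" for j
  proof -
    \<comment> \<open>Column \<open>j\<close> of \<open>A\<close> is the image of the \<open>j\<close>-th unit vector.\<close>
    define u :: vtensor where "u = (\<lambda>k\<in>?I. if k = j then 1 else 0)"
    have "einstein_vec n N A u \<in> tensor_range n N B"
      using sub by (auto simp: tensor_range_def u_def vtensors_def)
    then obtain v where v: "einstein_vec n N A u = einstein_vec n N B v"
      by (auto simp: tensor_range_def)
    have "A i j = (\<Sum>k\<in>?I. B i k * v k)" if i: "i \<in> ?I" for i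
    proof -
      have "A i j = einstein_vec n N A u i"
        using i j by (simp add: einstein_vec_def u_def if_distrib[of "\<lambda>x. _ * x"] cong: if_cong)
      also have "\<dots> = einstein_vec n N B v i" by (simp only: v)
      finally show ?thesis using i by (simp add: einstein_vec_def)
    qed
    then show ?thesis by blast
  qed
  then obtain v where v: "\<forall>j\<in>?I. \<forall>i\<in>?I. A i j = (\<Sum>k\<in>?I. B i k * v j k)" by metis
  define Y where "Y = (\<lambda>k\<in>?I. \<lambda>j\<in>?I. v j k)"
  have Y: "Y \<in> tensors n N" by (auto simp: Y_def tensors_def)
  have "A = einstein n N B Y"
  proof (rule tensors_eqI)
    fix i j assume "i \<in> ?I" "j \<in> ?I"
    then show "A i j = einstein n N B Y i j" using v by (simp add: einstein_def Y_def)
  qed (use A in simp_all)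
  then show ?thesis using that Y by blast
qed

text \<open>The least exponent in the definition of the index is attained, so index one says that
  \<open>A\<close> and \<open>A\<^sup>2\<close> have the same range.\<close>

lemma core_tensor_factor:
  assumes "core_tensor n N A"
  obtains Y where "Y \<in> tensors n N" "A = einstein n N (einstein n N A A) Y"
proof -
  have A: "A \<in> tensors n N" and ind: "tensor_ind n N A = 1"
    using assms by (auto simp: core_tensor_def)
  let ?P = "tensor_pow n N A"
  define Q where "Q k \<longleftrightarrow> 1 \<le> k \<and> tensor_range n N (?P k) = tensor_range n N (?P (k + 1))" for k
  obtain m S where m: "?P m = einstein n N (?P (Suc m)) S"
    using tensor_pi_regular[OF A] by blast
  have "?P (Suc m) = einstein n N A (?P m)" by simp
  also have "\<dots> = einstein n N A (einstein n N (?P (Suc m)) S)" by (rule arg_cong[OF m])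
  also have "\<dots> = einstein n N (?P (Suc (Suc m))) S" by (simp add: einstein_assoc)
  finally have "tensor_range n N (?P (Suc m)) \<subseteq> tensor_range n N (?P (Suc (Suc m)))"
    by (metis tensor_range_einstein_subset)
  moreover have "tensor_range n N (?P (Suc (Suc m))) \<subseteq> tensor_range n N (?P (Suc m))"
    using tensor_pow_Suc_right[OF A, of "Suc m"] by (metis tensor_range_einstein_subset)
  ultimately have "Q (Suc m)" by (simp add: Q_def)
  then have "Q (tensor_ind n N A)" unfolding tensor_ind_def Q_def by (rule LeastI)
  then have "tensor_range n N A \<subseteq> tensor_range n N (einstein n N A A)"
    using A by (simp add: ind Q_def einstein_id_right)
  then show ?thesis using tensor_range_subset_imp_factor[OF A] that by blast
qed

lemma is_core_inverse_iff:
  assumes "A \<in> tensors n N"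
  shows "is_core_inverse n N A X \<longleftrightarrow> tensor.core_inv_of n N A X"
  using assms
  by (auto simp: is_core_inverse_def tensor.core_inv_of_def numeral_2_eq_2 einstein_id_right)

lemma core_inverse_eqI:
  assumes "A \<in> tensors n N" "tensor.core_inv_of n N A X"
  shows "core_inverse n N A = X"
  unfolding core_inverse_def
  by (rule the_equality) (use assms tensor.core_inv_unique in \<open>auto simp: is_core_inverse_iff\<close>)

lemma core_inv_of_core_inverse:
  assumes "core_tensor n N A"
  shows "tensor.core_inv_of n N A (core_inverse n N A)"
proof -
  have A: "A \<in> tensors n N" using assms by (simp add: core_tensor_def)
  obtain Y where "Y \<in> tensors n N" "A = einstein n N (einstein n N A A) Y"
    using core_tensor_factor[OF assms] .
  then obtain X where "tensor.core_inv_of n N A X"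
    using tensor.core_inv_exists[of A n N Y] A by auto
  then show ?thesis using core_inverse_eqI[OF A] by simp
qed

theorem theorem4p6:
  fixes n :: nat and N :: "nat \<Rightarrow> nat" and A B :: tensor
  assumes "1 \<le> n" and "\<And>k. k \<in> {1..n} \<Longrightarrow> 1 \<le> N k"
    and "core_tensor n N A" and "core_tensor n N B"
    and "tensor_ind n N (einstein n N A B) = 1"
  shows "(tensor_unitary n N B \<and>
          tensor_range n N (einstein n N (tensor_adj n N B) (core_inverse n N A))
            \<subseteq> tensor_range n N (core_inverse n N A)
          \<longrightarrow> core_inverse n N (einstein n N A B)
                = einstein n N (tensor_adj n N B) (core_inverse n N A))
       \<and> (tensor_unitary n N A \<and> tensor_range n N A \<subseteq> tensor_range n N B
          \<longrightarrow> core_inverse n N (einstein n N A B)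
                = einstein n N (core_inverse n N B) (tensor_adj n N A))"
proof (intro conjI impI; elim conjE)
  have A: "A \<in> tensors n N" and B: "B \<in> tensors n N"
    using assms by (auto simp: core_tensor_def)
  {
    assume un: "tensor_unitary n N B"
      and sub: "tensor_range n N (einstein n N (tensor_adj n N B) (core_inverse n N A))
                  \<subseteq> tensor_range n N (core_inverse n N A)"
    obtain Y where "Y \<in> tensors n N"
      "einstein n N (tensor_adj n N B) (core_inverse n N A) = einstein n N (core_inverse n N A) Y"
      using tensor_range_subset_imp_factor[OF einstein_closed sub] .
    then show "core_inverse n N (einstein n N A B)
        = einstein n N (tensor_adj n N B) (core_inverse n N A)"
      using tensor.core_inv_mult_invertible_right[of A n N B "tensor_adj n N B" Y "core_inverse n N A"]
        A B un core_inv_of_core_inverse[OF assms(3)]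
      by (intro core_inverse_eqI) (auto simp: tensor_unitary_def)
  next
    assume un: "tensor_unitary n N A" and sub: "tensor_range n N A \<subseteq> tensor_range n N B"
    let ?A' = "tensor_adj n N A"
    have AA': "einstein n N A ?A' = tensor_id n N" "einstein n N ?A' A = tensor_id n N"
      using un by (auto simp: tensor_unitary_def)
    obtain V where V: "V \<in> tensors n N" "A = einstein n N B V"
      using tensor_range_subset_imp_factor[OF A sub] .
    \<comment> \<open>A right inverse of \<open>B\<close>, since \<open>B V A\<^sup>* = A A\<^sup>* = I\<close>.\<close>
    define W where "W = einstein n N V ?A'"
    have W: "W \<in> tensors n N" by (simp add: W_def)
    have BW: "einstein n N B W = tensor_id n N"
      by (simp add: W_def einstein_assoc[symmetric] V(2)[symmetric] AA'(1))
    have WB: "einstein n N W B = tensor_id n N"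
      using tensor.right_inverse_imp_left_inverse[of B n N W] B W BW by simp
    have "core_inverse n N B = W"
      using tensor.core_inv_of_inverse[of B n N W] B W BW WB by (intro core_inverse_eqI) auto
    moreover have "einstein n N (einstein n N A B) (einstein n N W ?A') = tensor_id n N"
      by (metis AA'(1) BW einstein_assoc einstein_id_right A)
    moreover have "einstein n N (einstein n N W ?A') (einstein n N A B) = tensor_id n N"
      by (metis AA'(2) WB einstein_assoc einstein_id_left B)
    ultimately show "core_inverse n N (einstein n N A B)
        = einstein n N (core_inverse n N B) ?A'"
      using tensor.core_inv_of_inverse[of "einstein n N A B" n N "einstein n N W ?A'"]
      by (intro core_inverse_eqI) auto
  }
qed

end
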